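(* Let $(L,L^* )$ be either the pair $(\mathrm{sMC},\mathrm{sMC}^* )$ or the pair $(\mathrm{sCN},\mathrm{sCN}^* )$ of sequent calculi. For every finite set $\Gamma$ of formulas and every formula $\gamma$: (1) $L\vdash\Gamma\Rightarrow\gamma$ if and only if $L^*\vdash\Gamma\Rightarrow\gamma$; (2) $L-(\mathrm{cut})\vdash\Gamma\Rightarrow\gamma$ if and only if $L^*-(\mathrm{cut})\vdash\Gamma\Rightarrow\gamma$.
   Context: Formulas are built from countably many propositional variables $p,q,\dots$ using the binary connectives $\land,\lor,\to$ and the unary connective $\sim$. A sequent is an expression $\Gamma\Rightarrow\gamma$ with $\Gamma$ a finite (possibly empty) set of formulas and $\gamma$ a single formula; $\alpha,\Gamma$ means $\{\alpha\}\cup\Gamma$ and $\Gamma,\Delta$ means $\Gamma\cup\Delta$. $L\vdash S$ means that the sequent $S$ is provable in the calculus $L$, and $L-(\mathrm{cut})$ is $L$ without the rule (cut). The calculus $\mathrm{sC}$ has the following initial sequents and rules ($p$ any propositional variable; $\alpha,\beta,\gamma$ any formulas; $\Gamma,\Delta,\Sigma$ any finite sets of formulas). Initial sequents: (init1) $p,\Gamma\Rightarrow p$; (init2) $\sim p,\Gamma\Rightarrow\sim p$. (cut): from $\Gamma\Rightarrow\alpha$ and $\alpha,\Sigma\Rightarrow\gamma$ infer $\Gamma,\Sigma\Rightarrow\gamma$. ($\to$left): from $\Gamma\Rightarrow\alpha$ and $\beta,\Delta\Rightarrow\gamma$ infer $\alpha\to\beta,\Gamma,\Delta\Rightarrow\gamma$.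 ($\to$right): from $\alpha,\Gamma\Rightarrow\beta$ infer $\Gamma\Rightarrow\alpha\to\beta$. ($\land$left): from $\alpha,\beta,\Gamma\Rightarrow\gamma$ infer $\alpha\land\beta,\Gamma\Rightarrow\gamma$. ($\land$right): from $\Gamma\Rightarrow\alpha$ and $\Gamma\Rightarrow\beta$ infer $\Gamma\Rightarrow\alpha\land\beta$. ($\lor$left): from $\alpha,\Gamma\Rightarrow\gamma$ and $\beta,\Gamma\Rightarrow\gamma$ infer $\alpha\lor\beta,\Gamma\Rightarrow\gamma$. ($\lor$right1), ($\lor$right2): from $\Gamma\Rightarrow\alpha$ (respectively $\Gamma\Rightarrow\beta$) infer $\Gamma\Rightarrow\alpha\lor\beta$. ($\sim$left): from $\alpha,\Gamma\Rightarrow\gamma$ infer $\sim\sim\alpha,\Gamma\Rightarrow\gamma$. ($\sim$right): from $\Gamma\Rightarrow\alpha$ infer $\Gamma\Rightarrow\sim\sim\alpha$. ($\sim\to$left): from $\Gamma\Rightarrow\alpha$ and $\sim\beta,\Delta\Rightarrow\gamma$ infer $\sim(\alpha\to\beta),\Gamma,\Delta\Rightarrow\gamma$. ($\sim\to$right): from $\alpha,\Gamma\Rightarrow\sim\beta$ infer $\Gamma\Rightarrow\sim(\alpha\to\beta)$. ($\sim\land$left): from $\sim\alpha,\Gamma\Rightarrow\gamma$ and $\sim\beta,\Gamma\Rightarrow\gamma$ infer $\sim(\alpha\land\beta),\Gamma\Rightarrow\gamma$. ($\sim\land$right1), ($\sim\land$right2): from $\Gamma\Rightarrow\sim\alpha$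 (respectively $\Gamma\Rightarrow\sim\beta$) infer $\Gamma\Rightarrow\sim(\alpha\land\beta)$. ($\sim\lor$left): from $\sim\alpha,\sim\beta,\Gamma\Rightarrow\gamma$ infer $\sim(\alpha\lor\beta),\Gamma\Rightarrow\gamma$. ($\sim\lor$right): from $\Gamma\Rightarrow\sim\alpha$ and $\Gamma\Rightarrow\sim\beta$ infer $\Gamma\Rightarrow\sim(\alpha\lor\beta)$. Additional rules: (ex-middle): from $\sim\alpha,\Gamma\Rightarrow\gamma$ and $\alpha,\Gamma\Rightarrow\gamma$ infer $\Gamma\Rightarrow\gamma$. (Peirce): from $\alpha\to\beta,\Gamma\Rightarrow\alpha$ infer $\Gamma\Rightarrow\alpha$. (g-ex-middle): from $\alpha\to\beta,\Gamma\Rightarrow\gamma$ and $\alpha,\Gamma\Rightarrow\gamma$ infer $\Gamma\Rightarrow\gamma$. $\mathrm{sC3}=\mathrm{sC}+$(ex-middle); $\mathrm{sMC}=\mathrm{sC}+$(Peirce); $\mathrm{sCN}=\mathrm{sC3}+$(Peirce); $\mathrm{sMC}^*=\mathrm{sC}+$(g-ex-middle); $\mathrm{sCN}^*=\mathrm{sC3}+$(g-ex-middle). *)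

theory Defs imports Main "HOL-Library.FSet" begin

datatype fm =
    Var nat
  | Conj fm fm  (infixr \<open>\<^bold>\<and>\<close> 75)
  | Disj fm fm  (infixr \<open>\<^bold>\<or>\<close> 74)
  | Impl fm fm  (infixr \<open>\<^bold>\<rightarrow>\<close> 73)
  | Neg fm  (\<open>\<^bold>\<sim>_\<close> [80] 80)

text \<open>All six calculi share the cut-free part of sC. A calculus is therefore given by the set of
  those rules among the following four that it contains in addition to this common part, and
  \<open>L - {Cut}\<close> is \<open>L\<close> without (cut).\<close>

datatype rule_name = Cut | ExMiddle | Peirce | GExMiddle

type_synonym calculus = "rule_name set"

text \<open>\<open>L \<turnstile> \<Gamma> \<Rrightarrow> \<gamma>\<close>: the sequent with antecedent \<open>\<Gamma>\<close> and succedent \<open>\<gamma>\<close> is provable in \<open>L\<close>.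
  As antecedents are sets, the principal or side formulas displayed by a rule may also occur in
  its context.\<close>

inductive provable :: "calculus \<Rightarrow> fm fset \<Rightarrow> fm \<Rightarrow> bool"  (\<open>_ \<turnstile> _ \<Rrightarrow> _\<close> [51, 51, 51] 50)
  for L :: calculus where
  init1: "L \<turnstile> finsert (Var p) \<Gamma> \<Rrightarrow> Var p"
| init2: "L \<turnstile> finsert (\<^bold>\<sim>Var p) \<Gamma> \<Rrightarrow> \<^bold>\<sim>Var p"
| impl_left: "L \<turnstile> \<Gamma> \<Rrightarrow> \<alpha> \<Longrightarrow> L \<turnstile> finsert \<beta> \<Delta> \<Rrightarrow> \<gamma>
    \<Longrightarrow> L \<turnstile> finsert (\<alpha> \<^bold>\<rightarrow> \<beta>) (\<Gamma> |\<union>| \<Delta>) \<Rrightarrow> \<gamma>"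
| impl_right: "L \<turnstile> finsert \<alpha> \<Gamma> \<Rrightarrow> \<beta> \<Longrightarrow> L \<turnstile> \<Gamma> \<Rrightarrow> \<alpha> \<^bold>\<rightarrow> \<beta>"
| conj_left: "L \<turnstile> finsert \<alpha> (finsert \<beta> \<Gamma>) \<Rrightarrow> \<gamma> \<Longrightarrow> L \<turnstile> finsert (\<alpha> \<^bold>\<and> \<beta>) \<Gamma> \<Rrightarrow> \<gamma>"
| conj_right: "L \<turnstile> \<Gamma> \<Rrightarrow> \<alpha> \<Longrightarrow> L \<turnstile> \<Gamma> \<Rrightarrow> \<beta> \<Longrightarrow> L \<turnstile> \<Gamma> \<Rrightarrow> \<alpha> \<^bold>\<and> \<beta>"
| disj_left: "L \<turnstile> finsert \<alpha> \<Gamma> \<Rrightarrow> \<gamma> \<Longrightarrow> L \<turnstile> finsert \<beta> \<Gamma> \<Rrightarrow> \<gamma>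
    \<Longrightarrow> L \<turnstile> finsert (\<alpha> \<^bold>\<or> \<beta>) \<Gamma> \<Rrightarrow> \<gamma>"
| disj_right1: "L \<turnstile> \<Gamma> \<Rrightarrow> \<alpha> \<Longrightarrow> L \<turnstile> \<Gamma> \<Rrightarrow> \<alpha> \<^bold>\<or> \<beta>"
| disj_right2: "L \<turnstile> \<Gamma> \<Rrightarrow> \<beta> \<Longrightarrow> L \<turnstile> \<Gamma> \<Rrightarrow> \<alpha> \<^bold>\<or> \<beta>"
| neg_left: "L \<turnstile> finsert \<alpha> \<Gamma> \<Rrightarrow> \<gamma> \<Longrightarrow> L \<turnstile> finsert (\<^bold>\<sim>\<^bold>\<sim>\<alpha>) \<Gamma> \<Rrightarrow> \<gamma>"
| neg_right: "L \<turnstile> \<Gamma> \<Rrightarrow> \<alpha> \<Longrightarrow> L \<turnstile> \<Gamma> \<Rrightarrow> \<^bold>\<sim>\<^bold>\<sim>\<alpha>"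
| neg_impl_left: "L \<turnstile> \<Gamma> \<Rrightarrow> \<alpha> \<Longrightarrow> L \<turnstile> finsert (\<^bold>\<sim>\<beta>) \<Delta> \<Rrightarrow> \<gamma>
    \<Longrightarrow> L \<turnstile> finsert (\<^bold>\<sim>(\<alpha> \<^bold>\<rightarrow> \<beta>)) (\<Gamma> |\<union>| \<Delta>) \<Rrightarrow> \<gamma>"
| neg_impl_right: "L \<turnstile> finsert \<alpha> \<Gamma> \<Rrightarrow> \<^bold>\<sim>\<beta> \<Longrightarrow> L \<turnstile> \<Gamma> \<Rrightarrow> \<^bold>\<sim>(\<alpha> \<^bold>\<rightarrow> \<beta>)"
| neg_conj_left: "L \<turnstile> finsert (\<^bold>\<sim>\<alpha>) \<Gamma> \<Rrightarrow> \<gamma> \<Longrightarrow> L \<turnstile> finsert (\<^bold>\<sim>\<beta>) \<Gamma> \<Rrightarrow> \<gamma>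
    \<Longrightarrow> L \<turnstile> finsert (\<^bold>\<sim>(\<alpha> \<^bold>\<and> \<beta>)) \<Gamma> \<Rrightarrow> \<gamma>"
| neg_conj_right1: "L \<turnstile> \<Gamma> \<Rrightarrow> \<^bold>\<sim>\<alpha> \<Longrightarrow> L \<turnstile> \<Gamma> \<Rrightarrow> \<^bold>\<sim>(\<alpha> \<^bold>\<and> \<beta>)"
| neg_conj_right2: "L \<turnstile> \<Gamma> \<Rrightarrow> \<^bold>\<sim>\<beta> \<Longrightarrow> L \<turnstile> \<Gamma> \<Rrightarrow> \<^bold>\<sim>(\<alpha> \<^bold>\<and> \<beta>)"
| neg_disj_left: "L \<turnstile> finsert (\<^bold>\<sim>\<alpha>) (finsert (\<^bold>\<sim>\<beta>) \<Gamma>) \<Rrightarrow> \<gamma>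
    \<Longrightarrow> L \<turnstile> finsert (\<^bold>\<sim>(\<alpha> \<^bold>\<or> \<beta>)) \<Gamma> \<Rrightarrow> \<gamma>"
| neg_disj_right: "L \<turnstile> \<Gamma> \<Rrightarrow> \<^bold>\<sim>\<alpha> \<Longrightarrow> L \<turnstile> \<Gamma> \<Rrightarrow> \<^bold>\<sim>\<beta> \<Longrightarrow> L \<turnstile> \<Gamma> \<Rrightarrow> \<^bold>\<sim>(\<alpha> \<^bold>\<or> \<beta>)"
| cut: "Cut \<in> L \<Longrightarrow> L \<turnstile> \<Gamma> \<Rrightarrow> \<alpha> \<Longrightarrow> L \<turnstile> finsert \<alpha> \<Sigma> \<Rrightarrow> \<gamma> \<Longrightarrow> L \<turnstile> \<Gamma> |\<union>| \<Sigma> \<Rrightarrow> \<gamma>"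
| ex_middle: "ExMiddle \<in> L \<Longrightarrow> L \<turnstile> finsert (\<^bold>\<sim>\<alpha>) \<Gamma> \<Rrightarrow> \<gamma> \<Longrightarrow> L \<turnstile> finsert \<alpha> \<Gamma> \<Rrightarrow> \<gamma>
    \<Longrightarrow> L \<turnstile> \<Gamma> \<Rrightarrow> \<gamma>"
| peirce: "Peirce \<in> L \<Longrightarrow> L \<turnstile> finsert (\<alpha> \<^bold>\<rightarrow> \<beta>) \<Gamma> \<Rrightarrow> \<alpha> \<Longrightarrow> L \<turnstile> \<Gamma> \<Rrightarrow> \<alpha>"
| g_ex_middle: "GExMiddle \<in> L \<Longrightarrow> L \<turnstile> finsert (\<alpha> \<^bold>\<rightarrow> \<beta>) \<Gamma> \<Rrightarrow> \<gamma> \<Longrightarrow> L \<turnstile> finsert \<alpha> \<Gamma> \<Rrightarrow> \<gamma>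
    \<Longrightarrow> L \<turnstile> \<Gamma> \<Rrightarrow> \<gamma>"

definition sC :: calculus where "sC = {Cut}"
definition sC3 :: calculus where "sC3 = sC \<union> {ExMiddle}"
definition sMC :: calculus where "sMC = sC \<union> {Peirce}"
definition sCN :: calculus where "sCN = sC3 \<union> {Peirce}"
definition sMC_star :: calculus where "sMC_star = sC \<union> {GExMiddle}"
definition sCN_star :: calculus where "sCN_star = sC3 \<union> {GExMiddle}"

end

theory Submission imports Defs begin

text \<open>A calculus containing the Peirce rule or (g-ex-middle), with or without cut, is sound and
  complete for a two-valued semantics in which the literals \<open>p\<close> and \<open>\<sim>p\<close> are evaluated independently,
  except that (ex-middle) forces one of the two to hold. So provability depends only on whether
  (ex-middle) is present.

  For completeness without cut, start from an unprovable sequent \<open>\<Gamma> \<Rightarrow> \<gamma>\<close>. By the Peirce rule,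
  which follows from (g-ex-middle) since \<open>\<alpha>, \<Gamma> \<Rightarrow> \<alpha>\<close> is provable, all formulas \<open>\<gamma> \<rightarrow> \<chi>\<close> may be added
  to \<open>\<Gamma>\<close> without making \<open>\<gamma>\<close> derivable. After that, deriving \<open>\<gamma>\<close> means deriving everything, so that
  a maximal extension \<open>M\<close> not deriving \<open>\<gamma>\<close> is maximal among all sets that do not derive everything.
  Read the elements of \<open>M\<close> as true and the formulas not derivable from \<open>M\<close> as false. This is a
  Hintikka set: if \<open>\<alpha> \<rightarrow> \<beta>\<close> is not derivable from \<open>M\<close>, then \<open>M, \<alpha>\<close> does not derive \<open>\<beta>\<close>, and
  maximality gives \<open>\<alpha> \<in> M\<close>.\<close>

section \<open>Structural properties\<close>

text \<open>The initial sequents carry an arbitrary context. In the case of a left rule the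
  principal formula already lies in \<Delta>, so the rule can be applied with \<Delta> itself as
  every context, and set insertion absorbs the repetition.\<close>

lemma weakening:
  assumes "L \<turnstile> \<Gamma> \<Rrightarrow> \<gamma>" and "\<Gamma> |\<subseteq>| \<Delta>"
  shows "L \<turnstile> \<Delta> \<Rrightarrow> \<gamma>"
  using assms
proof (induction arbitrary: \<Delta> rule: provable.induct)
  case (init1 p \<Gamma>)
  then show ?case using provable.init1[of L p \<Delta>] by (simp add: finsert_absorb)
next
  case (init2 p \<Gamma>)
  then show ?case using provable.init2[of L p \<Delta>] by (simp add: finsert_absorb)
next
  case (impl_left \<Gamma> \<alpha> \<beta> \<Sigma> \<gamma>)
  then have "L \<turnstile> \<Delta> \<Rrightarrow> \<alpha>" and "L \<turnstile> finsert \<beta> \<Delta> \<Rrightarrow> \<gamma>" by (auto simp: less_eq_fset.rep_eq)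
  from provable.impl_left[OF this] impl_left.prems show ?case by (simp add: finsert_absorb)
next
  case (neg_impl_left \<Gamma> \<alpha> \<beta> \<Sigma> \<gamma>)
  then have "L \<turnstile> \<Delta> \<Rrightarrow> \<alpha>" and "L \<turnstile> finsert (\<^bold>\<sim>\<beta>) \<Delta> \<Rrightarrow> \<gamma>" by (auto simp: less_eq_fset.rep_eq)
  from provable.neg_impl_left[OF this] neg_impl_left.prems show ?case by (simp add: finsert_absorb)
next
  case (conj_left \<alpha> \<beta> \<Gamma> \<gamma>)
  then have "L \<turnstile> finsert \<alpha> (finsert \<beta> \<Delta>) \<Rrightarrow> \<gamma>" by (auto simp: less_eq_fset.rep_eq)
  from provable.conj_left[OF this] conj_left.prems show ?case by (simp add: finsert_absorb)
next
  case (disj_left \<alpha> \<Gamma> \<gamma> \<beta>)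
  then have "L \<turnstile> finsert \<alpha> \<Delta> \<Rrightarrow> \<gamma>" and "L \<turnstile> finsert \<beta> \<Delta> \<Rrightarrow> \<gamma>"
    by (auto simp: less_eq_fset.rep_eq)
  from provable.disj_left[OF this] disj_left.prems show ?case by (simp add: finsert_absorb)
next
  case (neg_left \<alpha> \<Gamma> \<gamma>)
  then have "L \<turnstile> finsert \<alpha> \<Delta> \<Rrightarrow> \<gamma>" by (auto simp: less_eq_fset.rep_eq)
  from provable.neg_left[OF this] neg_left.prems show ?case by (simp add: finsert_absorb)
next
  case (neg_conj_left \<alpha> \<Gamma> \<gamma> \<beta>)
  then have "L \<turnstile> finsert (\<^bold>\<sim>\<alpha>) \<Delta> \<Rrightarrow> \<gamma>" and "L \<turnstile> finsert (\<^bold>\<sim>\<beta>) \<Delta> \<Rrightarrow> \<gamma>"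
    by (auto simp: less_eq_fset.rep_eq)
  from provable.neg_conj_left[OF this] neg_conj_left.prems show ?case by (simp add: finsert_absorb)
next
  case (neg_disj_left \<alpha> \<beta> \<Gamma> \<gamma>)
  then have "L \<turnstile> finsert (\<^bold>\<sim>\<alpha>) (finsert (\<^bold>\<sim>\<beta>) \<Delta>) \<Rrightarrow> \<gamma>" by (auto simp: less_eq_fset.rep_eq)
  from provable.neg_disj_left[OF this] neg_disj_left.prems show ?case by (simp add: finsert_absorb)
next
  case (cut \<Gamma> \<alpha> \<Sigma> \<gamma>)
  then have "L \<turnstile> \<Delta> \<Rrightarrow> \<alpha>" and "L \<turnstile> finsert \<alpha> \<Delta> \<Rrightarrow> \<gamma>" by (auto simp: less_eq_fset.rep_eq)
  from provable.cut[OF \<open>Cut \<in> L\<close> this] show ?case by simp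
next
  case (ex_middle \<alpha> \<Gamma> \<gamma>)
  then show ?case by (metis provable.ex_middle finsert_mono)
next
  case (peirce \<alpha> \<beta> \<Gamma>)
  then show ?case by (metis provable.peirce finsert_mono)
next
  case (g_ex_middle \<alpha> \<beta> \<Gamma> \<gamma>)
  then show ?case by (metis provable.g_ex_middle finsert_mono)
next
  case (impl_right \<alpha> \<Gamma> \<beta>)
  then show ?case by (metis provable.impl_right finsert_mono)
next
  case (neg_impl_right \<alpha> \<Gamma> \<beta>)
  then show ?case by (metis provable.neg_impl_right finsert_mono)
qed (simp_all add: provable.conj_right provable.disj_right1 provable.disj_right2 provable.neg_right
    provable.neg_conj_right1 provable.neg_conj_right2 provable.neg_disj_right)

text \<open>Maximal sets in the completeness proof are infinite, while antecedents are finite; a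
  derivation uses only a finite part of the set.\<close>

definition derivable :: "calculus \<Rightarrow> fm set \<Rightarrow> fm \<Rightarrow> bool" where
  "derivable L X \<gamma> \<longleftrightarrow> (\<exists>\<Gamma>. fset \<Gamma> \<subseteq> X \<and> L \<turnstile> \<Gamma> \<Rrightarrow> \<gamma>)"

lemma derivable_fset [simp]: "derivable L (fset \<Gamma>) \<gamma> \<longleftrightarrow> L \<turnstile> \<Gamma> \<Rrightarrow> \<gamma>"
  unfolding derivable_def using weakening by (auto simp: less_eq_fset.rep_eq)

lemma derivable_mono: "derivable L X \<gamma> \<Longrightarrow> X \<subseteq> Y \<Longrightarrow> derivable L Y \<gamma>"
  unfolding derivable_def by blast

lemma derivable_insertE:
  assumes "derivable L (insert \<alpha> X) \<gamma>"
  obtains \<Gamma> where "fset \<Gamma> \<subseteq> X" and "L \<turnstile> finsert \<alpha> \<Gamma> \<Rrightarrow> \<gamma>"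
proof -
  from assms obtain \<Gamma> where \<Gamma>: "fset \<Gamma> \<subseteq> insert \<alpha> X" "L \<turnstile> \<Gamma> \<Rrightarrow> \<gamma>"
    unfolding derivable_def by blast
  show thesis
  proof
    show "fset (\<Gamma> |-| {|\<alpha>|}) \<subseteq> X" using \<Gamma>(1) by auto
    \<comment> \<open>Weakening covers the case that \<alpha> does not occur in \<Gamma>.\<close>
    show "L \<turnstile> finsert \<alpha> (\<Gamma> |-| {|\<alpha>|}) \<Rrightarrow> \<gamma>"
      using \<Gamma>(2) by (rule weakening) (auto simp: less_eq_fset.rep_eq)
  qed
qed

text \<open>Rules with a shared context need one finite set for both premises; the union of the two
  finite parts serves, by weakening.\<close>

lemma derivable_insert2E:
  assumes "derivable L (insert \<alpha> X) \<gamma>" and "derivable L (insert \<beta> X) \<delta>"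
  obtains \<Gamma> where "fset \<Gamma> \<subseteq> X" and "L \<turnstile> finsert \<alpha> \<Gamma> \<Rrightarrow> \<gamma>" and "L \<turnstile> finsert \<beta> \<Gamma> \<Rrightarrow> \<delta>"
proof -
  from assms obtain \<Gamma> \<Delta> where *: "fset \<Gamma> \<subseteq> X" "L \<turnstile> finsert \<alpha> \<Gamma> \<Rrightarrow> \<gamma>"
    "fset \<Delta> \<subseteq> X" "L \<turnstile> finsert \<beta> \<Delta> \<Rrightarrow> \<delta>"
    by (meson derivable_insertE)
  show thesis
  proof
    show "fset (\<Gamma> |\<union>| \<Delta>) \<subseteq> X" using * by simp
    show "L \<turnstile> finsert \<alpha> (\<Gamma> |\<union>| \<Delta>) \<Rrightarrow> \<gamma>"
      using *(2) by (rule weakening) (auto simp: less_eq_fset.rep_eq)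
    show "L \<turnstile> finsert \<beta> (\<Gamma> |\<union>| \<Delta>) \<Rrightarrow> \<delta>"
      using *(4) by (rule weakening) (auto simp: less_eq_fset.rep_eq)
  qed
qed

lemma derivable2E:
  assumes "derivable L X \<gamma>" and "derivable L X \<delta>"
  obtains \<Gamma> where "fset \<Gamma> \<subseteq> X" and "L \<turnstile> \<Gamma> \<Rrightarrow> \<gamma>" and "L \<turnstile> \<Gamma> \<Rrightarrow> \<delta>"
proof -
  from assms obtain \<Gamma> \<Delta> where *: "fset \<Gamma> \<subseteq> X" "L \<turnstile> \<Gamma> \<Rrightarrow> \<gamma>" "fset \<Delta> \<subseteq> X" "L \<turnstile> \<Delta> \<Rrightarrow> \<delta>"
    unfolding derivable_def by blast
  show thesis
  proof
    show "fset (\<Gamma> |\<union>| \<Delta>) \<subseteq> X" using * by simp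
    show "L \<turnstile> \<Gamma> |\<union>| \<Delta> \<Rrightarrow> \<gamma>" using *(2) by (rule weakening) simp
    show "L \<turnstile> \<Gamma> |\<union>| \<Delta> \<Rrightarrow> \<delta>" using *(4) by (rule weakening) simp
  qed
qed

lemma derivable_right:
  "derivable L (insert \<alpha> X) \<beta> \<Longrightarrow> derivable L X (\<alpha> \<^bold>\<rightarrow> \<beta>)"
  "derivable L X \<alpha> \<Longrightarrow> derivable L X \<beta> \<Longrightarrow> derivable L X (\<alpha> \<^bold>\<and> \<beta>)"
  "derivable L X \<alpha> \<Longrightarrow> derivable L X (\<alpha> \<^bold>\<or> \<beta>)"
  "derivable L X \<beta> \<Longrightarrow> derivable L X (\<alpha> \<^bold>\<or> \<beta>)"
  "derivable L X \<alpha> \<Longrightarrow> derivable L X (\<^bold>\<sim>\<^bold>\<sim>\<alpha>)"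
  "derivable L (insert \<alpha> X) (\<^bold>\<sim>\<beta>) \<Longrightarrow> derivable L X (\<^bold>\<sim>(\<alpha> \<^bold>\<rightarrow> \<beta>))"
  "derivable L X (\<^bold>\<sim>\<alpha>) \<Longrightarrow> derivable L X (\<^bold>\<sim>(\<alpha> \<^bold>\<and> \<beta>))"
  "derivable L X (\<^bold>\<sim>\<beta>) \<Longrightarrow> derivable L X (\<^bold>\<sim>(\<alpha> \<^bold>\<and> \<beta>))"
  "derivable L X (\<^bold>\<sim>\<alpha>) \<Longrightarrow> derivable L X (\<^bold>\<sim>\<beta>) \<Longrightarrow> derivable L X (\<^bold>\<sim>(\<alpha> \<^bold>\<or> \<beta>))"
proof -
  show "derivable L (insert \<alpha> X) \<beta> \<Longrightarrow> derivable L X (\<alpha> \<^bold>\<rightarrow> \<beta>)"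
    by (erule derivable_insertE) (auto simp: derivable_def intro: provable.impl_right)
  show "derivable L (insert \<alpha> X) (\<^bold>\<sim>\<beta>) \<Longrightarrow> derivable L X (\<^bold>\<sim>(\<alpha> \<^bold>\<rightarrow> \<beta>))"
    by (erule derivable_insertE) (auto simp: derivable_def intro: provable.neg_impl_right)
  show "derivable L X \<alpha> \<Longrightarrow> derivable L X \<beta> \<Longrightarrow> derivable L X (\<alpha> \<^bold>\<and> \<beta>)"
    by (erule (1) derivable2E) (auto simp: derivable_def intro: provable.conj_right)
  show "derivable L X (\<^bold>\<sim>\<alpha>) \<Longrightarrow> derivable L X (\<^bold>\<sim>\<beta>) \<Longrightarrow> derivable L X (\<^bold>\<sim>(\<alpha> \<^bold>\<or> \<beta>))"
    by (erule (1) derivable2E) (auto simp: derivable_def intro: provable.neg_disj_right)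
qed (auto simp: derivable_def intro: provable.disj_right1 provable.disj_right2 provable.neg_right
    provable.neg_conj_right1 provable.neg_conj_right2)

text \<open>The principal formula stays in \<open>X\<close>. Read backwards, the rules therefore
  only enlarge the set, as the argument with maximal sets requires.\<close>

lemma derivable_left:
  "\<alpha> \<^bold>\<rightarrow> \<beta> \<in> X \<Longrightarrow> derivable L X \<alpha> \<Longrightarrow> derivable L (insert \<beta> X) \<gamma> \<Longrightarrow> derivable L X \<gamma>"
  "\<alpha> \<^bold>\<and> \<beta> \<in> X \<Longrightarrow> derivable L (insert \<alpha> (insert \<beta> X)) \<gamma> \<Longrightarrow> derivable L X \<gamma>"
  "\<alpha> \<^bold>\<or> \<beta> \<in> X \<Longrightarrow> derivable L (insert \<alpha> X) \<gamma> \<Longrightarrow> derivable L (insert \<beta> X) \<gamma>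
    \<Longrightarrow> derivable L X \<gamma>"
  "\<^bold>\<sim>\<^bold>\<sim>\<alpha> \<in> X \<Longrightarrow> derivable L (insert \<alpha> X) \<gamma> \<Longrightarrow> derivable L X \<gamma>"
  "\<^bold>\<sim>(\<alpha> \<^bold>\<rightarrow> \<beta>) \<in> X \<Longrightarrow> derivable L X \<alpha> \<Longrightarrow> derivable L (insert (\<^bold>\<sim>\<beta>) X) \<gamma>
    \<Longrightarrow> derivable L X \<gamma>"
  "\<^bold>\<sim>(\<alpha> \<^bold>\<and> \<beta>) \<in> X \<Longrightarrow> derivable L (insert (\<^bold>\<sim>\<alpha>) X) \<gamma> \<Longrightarrow> derivable L (insert (\<^bold>\<sim>\<beta>) X) \<gamma>
    \<Longrightarrow> derivable L X \<gamma>"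
  "\<^bold>\<sim>(\<alpha> \<^bold>\<or> \<beta>) \<in> X \<Longrightarrow> derivable L (insert (\<^bold>\<sim>\<alpha>) (insert (\<^bold>\<sim>\<beta>) X)) \<gamma> \<Longrightarrow> derivable L X \<gamma>"
proof -
  have principal: "derivable L X \<gamma>" if "\<phi> \<in> X" "fset \<Gamma> \<subseteq> X" "L \<turnstile> finsert \<phi> \<Gamma> \<Rrightarrow> \<gamma>" for \<phi> \<Gamma>
    using that unfolding derivable_def by (intro exI[of _ "finsert \<phi> \<Gamma>"]) auto
  have pair: "\<exists>\<Gamma>. fset \<Gamma> \<subseteq> X \<and> L \<turnstile> finsert \<phi> (finsert \<psi> \<Gamma>) \<Rrightarrow> \<gamma>"
    if d: "derivable L (insert \<phi> (insert \<psi> X)) \<gamma>" for \<phi> \<psi>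
  proof -
    obtain \<Gamma> where \<Gamma>: "fset \<Gamma> \<subseteq> insert \<psi> X" "L \<turnstile> finsert \<phi> \<Gamma> \<Rrightarrow> \<gamma>"
      using d by (rule derivable_insertE)
    show ?thesis
    proof (intro exI conjI)
      show "fset (\<Gamma> |-| {|\<psi>|}) \<subseteq> X" using \<Gamma>(1) by auto
      show "L \<turnstile> finsert \<phi> (finsert \<psi> (\<Gamma> |-| {|\<psi>|})) \<Rrightarrow> \<gamma>"
        using \<Gamma>(2) by (rule weakening) (auto simp: less_eq_fset.rep_eq)
    qed
  qed
  have mixed: "\<exists>\<Gamma> \<Delta>. fset (\<Gamma> |\<union>| \<Delta>) \<subseteq> X \<and> L \<turnstile> \<Gamma> \<Rrightarrow> \<alpha> \<and> L \<turnstile> finsert \<phi> \<Delta> \<Rrightarrow> \<gamma>"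
    if "derivable L X \<alpha>" "derivable L (insert \<phi> X) \<gamma>" for \<phi>
    using that by (metis derivable_def derivable_insertE le_sup_iff union_fset)
  show "\<alpha> \<^bold>\<rightarrow> \<beta> \<in> X \<Longrightarrow> derivable L X \<alpha> \<Longrightarrow> derivable L (insert \<beta> X) \<gamma> \<Longrightarrow> derivable L X \<gamma>"
    by (metis mixed principal provable.impl_left)
  show "\<^bold>\<sim>(\<alpha> \<^bold>\<rightarrow> \<beta>) \<in> X \<Longrightarrow> derivable L X \<alpha> \<Longrightarrow> derivable L (insert (\<^bold>\<sim>\<beta>) X) \<gamma>
    \<Longrightarrow> derivable L X \<gamma>"
    by (metis mixed principal provable.neg_impl_left)
  show "\<alpha> \<^bold>\<and> \<beta> \<in> X \<Longrightarrow> derivable L (insert \<alpha> (insert \<beta> X)) \<gamma> \<Longrightarrow> derivable L X \<gamma>"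
    by (metis pair principal provable.conj_left)
  show "\<^bold>\<sim>(\<alpha> \<^bold>\<or> \<beta>) \<in> X \<Longrightarrow> derivable L (insert (\<^bold>\<sim>\<alpha>) (insert (\<^bold>\<sim>\<beta>) X)) \<gamma> \<Longrightarrow> derivable L X \<gamma>"
    by (metis pair principal provable.neg_disj_left)
  show "\<alpha> \<^bold>\<or> \<beta> \<in> X \<Longrightarrow> derivable L (insert \<alpha> X) \<gamma> \<Longrightarrow> derivable L (insert \<beta> X) \<gamma>
    \<Longrightarrow> derivable L X \<gamma>"
    by (erule (1) derivable_insert2E) (rule principal, assumption, assumption, rule provable.disj_left)
  show "\<^bold>\<sim>(\<alpha> \<^bold>\<and> \<beta>) \<in> X \<Longrightarrow> derivable L (insert (\<^bold>\<sim>\<alpha>) X) \<gamma> \<Longrightarrow> derivable L (insert (\<^bold>\<sim>\<beta>) X) \<gamma>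
    \<Longrightarrow> derivable L X \<gamma>"
    by (erule (1) derivable_insert2E) (rule principal, assumption, assumption, rule provable.neg_conj_left)
  show "\<^bold>\<sim>\<^bold>\<sim>\<alpha> \<in> X \<Longrightarrow> derivable L (insert \<alpha> X) \<gamma> \<Longrightarrow> derivable L X \<gamma>"
    by (erule derivable_insertE) (rule principal, assumption, assumption, rule provable.neg_left)
qed

lemma derivable_ex_middle:
  assumes "ExMiddle \<in> L" and "derivable L (insert (\<^bold>\<sim>\<alpha>) X) \<gamma>" and "derivable L (insert \<alpha> X) \<gamma>"
  shows "derivable L X \<gamma>"
  using assms(2,3) by (rule derivable_insert2E) (metis assms(1) derivable_def provable.ex_middle)

section \<open>Semantics\<close>

text \<open>\<open>w\<close> gives the values of the negated variables. The clause for negated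
  implications is the connexive one, in accordance with their rules: the negation moves to the
  consequent and the implication remains.\<close>

fun holds :: "(nat \<Rightarrow> bool) \<Rightarrow> (nat \<Rightarrow> bool) \<Rightarrow> fm \<Rightarrow> bool" where
  "holds v w (Var p) \<longleftrightarrow> v p"
| "holds v w (\<alpha> \<^bold>\<and> \<beta>) \<longleftrightarrow> holds v w \<alpha> \<and> holds v w \<beta>"
| "holds v w (\<alpha> \<^bold>\<or> \<beta>) \<longleftrightarrow> holds v w \<alpha> \<or> holds v w \<beta>"
| "holds v w (\<alpha> \<^bold>\<rightarrow> \<beta>) \<longleftrightarrow> (holds v w \<alpha> \<longrightarrow> holds v w \<beta>)"
| "holds v w (\<^bold>\<sim>Var p) \<longleftrightarrow> w p"
| "holds v w (\<^bold>\<sim>(\<alpha> \<^bold>\<and> \<beta>)) \<longleftrightarrow> holds v w (\<^bold>\<sim>\<alpha>) \<or> holds v w (\<^bold>\<sim>\<beta>)"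
| "holds v w (\<^bold>\<sim>(\<alpha> \<^bold>\<or> \<beta>)) \<longleftrightarrow> holds v w (\<^bold>\<sim>\<alpha>) \<and> holds v w (\<^bold>\<sim>\<beta>)"
| "holds v w (\<^bold>\<sim>(\<alpha> \<^bold>\<rightarrow> \<beta>)) \<longleftrightarrow> (holds v w \<alpha> \<longrightarrow> holds v w (\<^bold>\<sim>\<beta>))"
| "holds v w (\<^bold>\<sim>\<^bold>\<sim>\<alpha>) \<longleftrightarrow> holds v w \<alpha>"

text \<open>The cases match the equations of \<open>holds\<close>, which lead from a negated
  compound to negations of its parts. These are not subformulas, so structural induction has to
  treat a formula and its negation together.\<close>

lemma fm_neg_induct
    [case_names Var Conj Disj Impl Neg_Var Neg_Conj Neg_Disj Neg_Impl Neg_Neg]: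
  assumes "\<And>p. P (Var p)"
    and "\<And>\<alpha> \<beta>. P \<alpha> \<Longrightarrow> P \<beta> \<Longrightarrow> P (\<alpha> \<^bold>\<and> \<beta>)"
    and "\<And>\<alpha> \<beta>. P \<alpha> \<Longrightarrow> P \<beta> \<Longrightarrow> P (\<alpha> \<^bold>\<or> \<beta>)"
    and "\<And>\<alpha> \<beta>. P \<alpha> \<Longrightarrow> P \<beta> \<Longrightarrow> P (\<alpha> \<^bold>\<rightarrow> \<beta>)"
    and "\<And>p. P (\<^bold>\<sim>Var p)"
    and "\<And>\<alpha> \<beta>. P (\<^bold>\<sim>\<alpha>) \<Longrightarrow> P (\<^bold>\<sim>\<beta>) \<Longrightarrow> P (\<^bold>\<sim>(\<alpha> \<^bold>\<and> \<beta>))"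
    and "\<And>\<alpha> \<beta>. P (\<^bold>\<sim>\<alpha>) \<Longrightarrow> P (\<^bold>\<sim>\<beta>) \<Longrightarrow> P (\<^bold>\<sim>(\<alpha> \<^bold>\<or> \<beta>))"
    and "\<And>\<alpha> \<beta>. P \<alpha> \<Longrightarrow> P (\<^bold>\<sim>\<beta>) \<Longrightarrow> P (\<^bold>\<sim>(\<alpha> \<^bold>\<rightarrow> \<beta>))"
    and "\<And>\<alpha>. P \<alpha> \<Longrightarrow> P (\<^bold>\<sim>\<^bold>\<sim>\<alpha>)"
  shows "P \<alpha>"
proof -
  have "P \<alpha> \<and> P (\<^bold>\<sim>\<alpha>)" by (induction \<alpha>) (auto intro: assms)
  then show ?thesis ..
qed

lemma derivable_assumption: "\<alpha> \<in> X \<Longrightarrow> derivable L X \<alpha>"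
proof (induction \<alpha> arbitrary: X rule: fm_neg_induct)
  case (Var p)
  then show ?case unfolding derivable_def
    by (intro exI[of _ "{|Var p|}"]) (simp add: provable.init1)
next
  case (Neg_Var p)
  then show ?case unfolding derivable_def
    by (intro exI[of _ "{|\<^bold>\<sim>Var p|}"]) (simp add: provable.init2)
next
  case (Conj \<alpha> \<beta>)
  show ?case
    by (rule derivable_left(2)[OF Conj.prems]) (simp_all add: derivable_right(2) Conj.IH)
next
  case (Disj \<alpha> \<beta>)
  show ?case
    by (rule derivable_left(3)[OF Disj.prems]) (simp_all add: derivable_right(3,4) Disj.IH)
next
  case (Impl \<alpha> \<beta>)
  show ?case
    \<comment> \<open>The right rule comes first here: it puts \<alpha> into the antecedent, where
      the first premise of the left rule needs it.\<close>
    by (rule derivable_right(1), rule derivable_left(1)[OF insertI2, OF Impl.prems])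
      (simp_all add: Impl.IH)
next
  case (Neg_Conj \<alpha> \<beta>)
  show ?case
    by (rule derivable_left(6)[OF Neg_Conj.prems]) (simp_all add: derivable_right(7,8) Neg_Conj.IH)
next
  case (Neg_Disj \<alpha> \<beta>)
  show ?case
    by (rule derivable_left(7)[OF Neg_Disj.prems]) (simp_all add: derivable_right(9) Neg_Disj.IH)
next
  case (Neg_Impl \<alpha> \<beta>)
  show ?case
    by (rule derivable_right(6), rule derivable_left(5)[OF insertI2, OF Neg_Impl.prems])
      (simp_all add: Neg_Impl.IH)
next
  case (Neg_Neg \<alpha>)
  show ?case
    by (rule derivable_left(4)[OF Neg_Neg.prems]) (simp_all add: derivable_right(5) Neg_Neg.IH)
qed

lemma holds_ex_middle: "\<forall>p. v p \<or> w p \<Longrightarrow> holds v w (\<^bold>\<sim>\<alpha>) \<or> holds v w \<alpha>"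
  by (induction \<alpha>) auto

text \<open>\<open>L\<close> enters only through the presence of (ex-middle), so calculi that agree
  on this rule have the same valid sequents. A variable and its negation may both be true.\<close>

definition valid :: "calculus \<Rightarrow> fm fset \<Rightarrow> fm \<Rightarrow> bool" where
  "valid L \<Gamma> \<gamma> \<longleftrightarrow> (\<forall>v w. (ExMiddle \<in> L \<longrightarrow> (\<forall>p. v p \<or> w p)) \<longrightarrow>
    (\<forall>\<alpha> |\<in>| \<Gamma>. holds v w \<alpha>) \<longrightarrow> holds v w \<gamma>)"

text \<open>Implication is evaluated classically, which validates (Peirce) and (g-ex-middle). For
  (ex-middle), the condition on literals extends to all formulas by
  \<open>holds_ex_middle\<close>.\<close>

lemma soundness: "L \<turnstile> \<Gamma> \<Rrightarrow> \<gamma> \<Longrightarrow> valid L \<Gamma> \<gamma>"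
proof (induction rule: provable.induct)
  case (ex_middle \<alpha> \<Gamma> \<gamma>)
  show ?case unfolding valid_def
  proof (intro allI impI)
    fix v w
    assume *: "ExMiddle \<in> L \<longrightarrow> (\<forall>p. v p \<or> w p)" "\<forall>\<alpha> |\<in>| \<Gamma>. holds v w \<alpha>"
    then have "holds v w (\<^bold>\<sim>\<alpha>) \<or> holds v w \<alpha>" using ex_middle.hyps holds_ex_middle by blast
    then show "holds v w \<gamma>" using * ex_middle.IH unfolding valid_def by auto
  qed
qed (auto simp: valid_def)

section \<open>Completeness\<close>

lemma peirce_admissible:
  assumes "Peirce \<in> L \<or> GExMiddle \<in> L" and "L \<turnstile> finsert (\<alpha> \<^bold>\<rightarrow> \<beta>) \<Gamma> \<Rrightarrow> \<alpha>"
  shows "L \<turnstile> \<Gamma> \<Rrightarrow> \<alpha>"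
proof -
  have "L \<turnstile> finsert \<alpha> \<Gamma> \<Rrightarrow> \<alpha>"
    using derivable_assumption[of \<alpha> "fset (finsert \<alpha> \<Gamma>)"] by (simp only: derivable_fset) simp
  then show ?thesis using assms provable.peirce provable.g_ex_middle by blast
qed

text \<open>A derivation uses only finitely many of the implications with antecedent \<gamma>. As
  the succedent is \<gamma> too, the Peirce rule removes them one by one.\<close>

lemma derivable_peirce:
  assumes L: "Peirce \<in> L \<or> GExMiddle \<in> L" and d: "derivable L (range (Impl \<gamma>) \<union> X) \<gamma>"
  shows "derivable L X \<gamma>"
proof -
  obtain \<Gamma> where \<Gamma>: "fset \<Gamma> \<subseteq> range (Impl \<gamma>) \<union> X" "L \<turnstile> \<Gamma> \<Rrightarrow> \<gamma>"
    using d unfolding derivable_def by blast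
  obtain D where "finite D" and D: "fset \<Gamma> - X = Impl \<gamma> ` D"
    using finite_subset_image[of "fset \<Gamma> - X" "Impl \<gamma>" UNIV] \<Gamma>(1) by auto
  \<comment> \<open>\<open>C\<close> collects the consequents of the implications to be removed, as
    a finite set on which induction is possible.\<close>
  then obtain C where C: "fset C = D" by (metis fset_cases mem_Collect_eq)
  define \<Delta> where "\<Delta> = ffilter (\<lambda>\<alpha>. \<alpha> \<in> X) \<Gamma>"
  have "L \<turnstile> Impl \<gamma> |`| C |\<union>| \<Delta> \<Rrightarrow> \<gamma>"
    using \<Gamma>(2) by (rule weakening) (use C D in \<open>auto simp: \<Delta>_def less_eq_fset.rep_eq\<close>)
  then have "L \<turnstile> \<Delta> \<Rrightarrow> \<gamma>"
  proof (induction C)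
    case (insert \<chi> C)
    have "L \<turnstile> finsert (\<gamma> \<^bold>\<rightarrow> \<chi>) (Impl \<gamma> |`| C |\<union>| \<Delta>) \<Rrightarrow> \<gamma>" using insert.prems by simp
    then show ?case by (rule insert.IH[OF peirce_admissible[OF L]])
  qed simp
  then show ?thesis unfolding derivable_def by (intro exI[of _ \<Delta>]) (auto simp: \<Delta>_def)
qed

lemma derivable_Union_chain:
  assumes "C \<noteq> {}" and "subset.chain \<A> C" and "derivable L (\<Union>C) \<gamma>"
  shows "\<exists>X \<in> C. derivable L X \<gamma>"
proof -
  obtain \<Gamma> where \<Gamma>: "fset \<Gamma> \<subseteq> \<Union>C" "L \<turnstile> \<Gamma> \<Rrightarrow> \<gamma>"
    using assms(3) unfolding derivable_def by blast
  obtain X where "X \<in> C" "fset \<Gamma> \<subseteq> X"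
    using finite_subset_Union_chain[OF finite_fset \<Gamma>(1) assms(1,2)] by blast
  then show ?thesis using \<Gamma>(2) unfolding derivable_def by blast
qed

lemma maximal_extension:
  assumes L: "Peirce \<in> L \<or> GExMiddle \<in> L" and "\<not> derivable L X \<gamma>"
  obtains M where "X \<subseteq> M" and "\<not> derivable L M \<gamma>"
    and "\<And>\<alpha> \<chi>. \<alpha> \<notin> M \<Longrightarrow> derivable L (insert \<alpha> M) \<chi>"
proof -
  define Y where "Y = range (Impl \<gamma>) \<union> X"
  define \<A> where "\<A> = {Z. Y \<subseteq> Z \<and> \<not> derivable L Z \<gamma>}"
  have "Y \<in> \<A>" using assms derivable_peirce unfolding \<A>_def Y_def by blast
  then have "\<A> \<noteq> {}" by blast
  moreover have "\<Union>C \<in> \<A>" if "C \<noteq> {}" "subset.chain \<A> C" for C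
  proof -
    have "C \<subseteq> \<A>" using that(2) by (simp add: subset_chain_def)
    then have "\<not> derivable L (\<Union>C) \<gamma>"
      using derivable_Union_chain[OF that, of L \<gamma>] unfolding \<A>_def by blast
    moreover have "Y \<subseteq> \<Union>C" using that(1) \<open>C \<subseteq> \<A>\<close> unfolding \<A>_def by blast
    ultimately show ?thesis unfolding \<A>_def by simp
  qed
  ultimately obtain M where M: "M \<in> \<A>" "\<forall>Z \<in> \<A>. M \<subseteq> Z \<longrightarrow> Z = M"
    using subset_Zorn_nonempty[of \<A>] by blast
  show thesis
  proof
    show "X \<subseteq> M" "\<not> derivable L M \<gamma>" using M(1) by (simp_all add: \<A>_def Y_def)
    fix \<alpha> \<chi> assume "\<alpha> \<notin> M"
    \<comment> \<open>Otherwise the extended set would be a proper superset of \<open>M\<close>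
      within the family \<A>.\<close>
    then have "derivable L (insert \<alpha> M) \<gamma>" using M unfolding \<A>_def by blast
    from _ this show "derivable L (insert \<alpha> M) \<chi>"
    proof (rule derivable_left(1))
      show "\<gamma> \<^bold>\<rightarrow> \<chi> \<in> insert \<alpha> M" using M(1) unfolding \<A>_def Y_def by blast
    qed (simp add: derivable_assumption)
  qed
qed

text \<open>Two implications replace the usual equivalence of truth and membership, since without
  cut the passage from derivability to membership is not immediate. They suffice: the first makes
  the antecedent true, the second makes an underivable succedent false.\<close>

lemma truth_lemma:
  assumes nontrivial: "\<not> derivable L M \<gamma>"
    and maximal: "\<And>\<alpha> \<chi>. \<alpha> \<notin> M \<Longrightarrow> derivable L (insert \<alpha> M) \<chi>"
  defines "v \<equiv> \<lambda>p. Var p \<in> M" and "w \<equiv> \<lambda>p. \<^bold>\<sim>Var p \<in> M"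
  shows "(\<alpha> \<in> M \<longrightarrow> holds v w \<alpha>) \<and> (holds v w \<alpha> \<longrightarrow> derivable L M \<alpha>)"
proof -
  have insert: "\<alpha> \<in> M" if "\<not> derivable L (insert \<alpha> M) \<chi>" for \<alpha> \<chi>
    using that maximal by blast
  \<comment> \<open>If either formula were missing from \<open>M\<close>, adding it alone would
    already derive \<gamma>.\<close>
  have insert2: "\<alpha> \<in> M \<and> \<beta> \<in> M" if "\<not> derivable L (insert \<alpha> (insert \<beta> M)) \<gamma>" for \<alpha> \<beta>
    using that maximal derivable_mono by (metis insert_commute subset_insertI)
  show ?thesis
  proof (induction \<alpha> rule: fm_neg_induct)
    case (Conj \<alpha> \<beta>)
    then show ?case
      using nontrivial derivable_left(2) derivable_right(2) insert2
      by (metis holds.simps(2))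
  next
    case (Disj \<alpha> \<beta>)
    then show ?case
      using nontrivial derivable_left(3) derivable_right(3,4) insert
      by (metis holds.simps(3))
  next
    case (Impl \<alpha> \<beta>)
    then show ?case
      \<comment> \<open>If the implication is in \<open>M\<close> and \<alpha> is true, then
        \<alpha> is derivable, so adding \<beta> cannot derive \<gamma> and \<beta> is in
        \<open>M\<close>. If the implication is not derivable, \<beta> is not derivable after adding
        \<alpha>, so \<alpha> is in \<open>M\<close>; hence \<alpha> is true and \<beta>
        false.\<close>
      using nontrivial derivable_left(1) derivable_right(1) insert derivable_mono[OF _ subset_insertI]
      by (metis holds.simps(4))
  next
    case (Neg_Conj \<alpha> \<beta>)
    then show ?case
      using nontrivial derivable_left(6) derivable_right(7,8) insert
      by (metis holds.simps(6))
  next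
    case (Neg_Disj \<alpha> \<beta>)
    then show ?case
      using nontrivial derivable_left(7) derivable_right(9) insert2
      by (metis holds.simps(7))
  next
    case (Neg_Impl \<alpha> \<beta>)
    then show ?case
      using nontrivial derivable_left(5) derivable_right(6) insert derivable_mono[OF _ subset_insertI]
      by (metis holds.simps(8))
  next
    case (Neg_Neg \<alpha>)
    then show ?case
      using nontrivial derivable_left(4) derivable_right(5) insert
      by (metis holds.simps(9))
  qed (auto simp: v_def w_def derivable_assumption)
qed

lemma completeness:
  assumes L: "Peirce \<in> L \<or> GExMiddle \<in> L" and "valid L \<Gamma> \<gamma>"
  shows "L \<turnstile> \<Gamma> \<Rrightarrow> \<gamma>"
proof (rule ccontr)
  assume "\<not> L \<turnstile> \<Gamma> \<Rrightarrow> \<gamma>"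
  then have "\<not> derivable L (fset \<Gamma>) \<gamma>" by simp
  then obtain M where M: "fset \<Gamma> \<subseteq> M" "\<not> derivable L M \<gamma>"
    "\<And>\<alpha> \<chi>. \<alpha> \<notin> M \<Longrightarrow> derivable L (insert \<alpha> M) \<chi>"
    using maximal_extension[OF L] by blast
  let ?v = "\<lambda>p. Var p \<in> M" and ?w = "\<lambda>p. \<^bold>\<sim>Var p \<in> M"
  note truth = truth_lemma[OF M(2,3)]
  \<comment> \<open>If a variable and its negation were both missing from \<open>M\<close>, adding
    either would derive \<gamma> by maximality, and (ex-middle) would derive \<gamma> from
    \<open>M\<close>.\<close>
  have "ExMiddle \<in> L \<longrightarrow> (\<forall>p. ?v p \<or> ?w p)"
    using M(2,3) derivable_ex_middle by blast
  moreover have "\<forall>\<alpha> |\<in>| \<Gamma>. holds ?v ?w \<alpha>" using truth M(1) by blast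
  ultimately have "holds ?v ?w \<gamma>"
    using assms(2)[unfolded valid_def, THEN spec[of _ ?v], THEN spec[of _ ?w]] by simp
  then show False using truth M(2) by simp
qed

theorem theorem2p12:
  fixes L L_star :: calculus and \<Gamma> :: "fm fset" and \<gamma> :: fm
  assumes "(L, L_star) = (sMC, sMC_star) \<or> (L, L_star) = (sCN, sCN_star)"
  shows "(L \<turnstile> \<Gamma> \<Rrightarrow> \<gamma> \<longleftrightarrow> L_star \<turnstile> \<Gamma> \<Rrightarrow> \<gamma>) \<and>
    (L - {Cut} \<turnstile> \<Gamma> \<Rrightarrow> \<gamma> \<longleftrightarrow> L_star - {Cut} \<turnstile> \<Gamma> \<Rrightarrow> \<gamma>)"
proof -
  \<comment> \<open>Removing \<open>Cut\<close> preserves the three membership conditions, so this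
    one fact yields both equivalences.\<close>
  have eq: "K \<turnstile> \<Gamma> \<Rrightarrow> \<gamma> \<longleftrightarrow> K' \<turnstile> \<Gamma> \<Rrightarrow> \<gamma>"
    if "Peirce \<in> K" "GExMiddle \<in> K'" "ExMiddle \<in> K \<longleftrightarrow> ExMiddle \<in> K'" for K K' :: calculus
  proof -
    have "valid K \<Gamma> \<gamma> \<longleftrightarrow> valid K' \<Gamma> \<gamma>" unfolding valid_def using that(3) by simp
    then show ?thesis using that(1,2) soundness completeness by blast
  qed
  show ?thesis
    using assms
    by (intro conjI; intro eq)
      (auto simp: sMC_def sCN_def sMC_star_def sCN_star_def sC_def sC3_def)
qed

end
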